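(* Let $G$ be a finite simple graph, $\Lambda\subseteq\Omega(G)$, $|\Lambda|\ge 1$. Then $G$ is a König–Egerváry graph if and only if $\bigcup\Lambda$ is critical and $\left|\bigcap\Lambda\right|+\left|\bigcup\Lambda\right|=2\alpha(G)$.
   Context: For $X\subseteq V(G)$, $N(X)$ is the set of vertices adjacent to some vertex of $X$, $d(X)=|X|-|N(X)|$, $d(G)=\max\{d(X):X\subseteq V(G)\}$, and $X$ is critical if $d(X)=d(G)$. $\alpha(G)$ is the maximum cardinality of an independent set, $\Omega(G)$ the family of maximum independent sets, $\mu(G)$ the size of a maximum matching. $G$ is König–Egerváry if $\alpha(G)+\mu(G)=|V(G)|$. *)

theory Defs
  imports "HOL-Library.Ramsey" "HOL-Library.Disjoint_Sets"
begin

text \<open>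
  A graph is a pair \<open>V\<close>, \<open>E\<close> of a vertex set and a set of two-element subsets of \<open>V\<close>.
  Independence of a vertex set is \<^const>\<open>indep\<close> from the library.
\<close>

definition fin_simple_graph :: "'a set \<Rightarrow> 'a set set \<Rightarrow> bool" where
  "fin_simple_graph V E \<longleftrightarrow> finite V \<and> E \<subseteq> [V]\<^bsup>2\<^esup>"

definition nbhd :: "'a set \<Rightarrow> 'a set set \<Rightarrow> 'a set \<Rightarrow> 'a set" where
  "nbhd V E X = {v \<in> V. \<exists>x\<in>X. {x, v} \<in> E}"

definition diff_set :: "'a set \<Rightarrow> 'a set set \<Rightarrow> 'a set \<Rightarrow> int" where
  "diff_set V E X = int (card X) - int (card (nbhd V E X))"

definition diff_graph :: "'a set \<Rightarrow> 'a set set \<Rightarrow> int" where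
  "diff_graph V E = Max {diff_set V E X | X. X \<subseteq> V}"

definition critical :: "'a set \<Rightarrow> 'a set set \<Rightarrow> 'a set \<Rightarrow> bool" where
  "critical V E X \<longleftrightarrow> X \<subseteq> V \<and> diff_set V E X = diff_graph V E"

definition indep_number :: "'a set \<Rightarrow> 'a set set \<Rightarrow> nat" where
  "indep_number V E = Max {card S | S. S \<subseteq> V \<and> indep S E}"

definition max_indep_sets :: "'a set \<Rightarrow> 'a set set \<Rightarrow> 'a set set" where
  "max_indep_sets V E = {S. S \<subseteq> V \<and> indep S E \<and> card S = indep_number V E}"

definition matching :: "'a set set \<Rightarrow> 'a set set \<Rightarrow> bool" where
  "matching E M \<longleftrightarrow> M \<subseteq> E \<and> disjoint M"

definition matching_number :: "'a set set \<Rightarrow> nat" where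
  "matching_number E = Max {card M | M. matching E M}"

definition konig_egervary :: "'a set \<Rightarrow> 'a set set \<Rightarrow> bool" where
  "konig_egervary V E \<longleftrightarrow> indep_number V E + matching_number E = card V"

end

theory Submission
  imports Defs
begin

text \<open>
  Write \<open>U = \<Union>\<Lambda>\<close> and \<open>I = \<Inter>\<Lambda>\<close>. Since the members of \<open>\<Lambda>\<close> are maximum independent sets, every
  vertex outside \<open>I\<close> has a neighbour in \<open>U\<close> and no vertex of \<open>I\<close> does, so \<open>N(U) = V - I\<close> and
  \<open>d(U) = |U| + |I| - |V|\<close>.

  If \<open>G\<close> is Koenig-Egervary with maximum matching \<open>M\<close>, then \<open>d(X) \<le> |V| - 2|M|\<close> for all \<open>X\<close>. Every
  maximum independent set contains all vertices missed by \<open>M\<close> and exactly one end of every edge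
  of \<open>M\<close>; hence the partner map exchanges the saturated vertices of \<open>U\<close> with those outside \<open>I\<close>,
  which gives \<open>|U| + |I| = 2\<alpha>\<close> and \<open>d(U) = 2\<alpha> - |V| = |V| - 2|M|\<close>.

  Conversely \<open>d(G) = d(U) = 2\<alpha> - |V|\<close>. For \<open>S \<in> \<Lambda>\<close> and \<open>A \<subseteq> V - S\<close>, the bound
  \<open>d(S - N(A)) \<le> 2\<alpha> - |V|\<close> is Hall's condition \<open>|A| \<le> |N(A) \<inter> S|\<close>, so \<open>V - S\<close> can be matched
  into \<open>S\<close> and \<open>\<mu> = |V| - \<alpha>\<close>.
\<close>

section \<open>Hall's marriage theorem\<close>

text \<open>
  Rado's argument: as long as some set has two elements, one of them can be deleted without
  violating Hall's condition, by submodularity of \<open>J \<mapsto> |\<Union>(A ` J)|\<close>.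
\<close>

theorem hall_marriage:
  fixes A :: "'i \<Rightarrow> 'b set"
  assumes "finite I" and "\<And>i. i \<in> I \<Longrightarrow> finite (A i)"
    and "\<And>J. J \<subseteq> I \<Longrightarrow> card J \<le> card (\<Union>(A ` J))"
  shows "\<exists>f. inj_on f I \<and> (\<forall>i\<in>I. f i \<in> A i)"
  using assms(2,3)
proof (induction "\<Sum>i\<in>I. card (A i)" arbitrary: A rule: less_induct)
  case less
  note fin = less.prems(1) and hall = less.prems(2)
  show ?case
  proof (cases "\<exists>i\<in>I. \<exists>x\<in>A i. \<exists>y\<in>A i. x \<noteq> y")
    \<comment> \<open>No set has two elements, so Hall's condition for single indices makes every
      set a singleton, and for pairs of indices it makes \<open>f\<close> injective.\<close>
    case False
    have ne: "A i \<noteq> {}" if "i \<in> I" for i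
      using hall[of "{i}"] that by auto
    define f where "f i = (SOME x. x \<in> A i)" for i
    have f: "f i \<in> A i" if "i \<in> I" for i
      using ne[OF that] unfolding f_def by (simp add: some_in_eq)
    have A: "A i = {f i}" if "i \<in> I" for i
      using f[OF that] False that by blast
    have "inj_on f I"
    proof (rule inj_onI)
      fix i j assume ij: "i \<in> I" "j \<in> I" "f i = f j"
      have "card {i, j} \<le> card (\<Union>(A ` {i, j}))"
        using ij by (intro hall) auto
      also have "\<Union>(A ` {i, j}) = {f i}"
        using A ij by auto
      finally show "i = j"
        by (auto simp: card_insert_if split: if_splits)
    qed
    with f show ?thesis by blast
  next
    case True
    then obtain i x y where i: "i \<in> I" and xy: "x \<in> A i" "y \<in> A i" "x \<noteq> y"
      by blast
    have step: "\<exists>f. inj_on f I \<and> (\<forall>i\<in>I. f i \<in> A i)"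
      if z: "z \<in> A i" and ok: "\<And>J. J \<subseteq> I \<Longrightarrow> card J \<le> card (\<Union>((A(i := A i - {z})) ` J))" for z
    proof -
      let ?B = "A(i := A i - {z})"
      have "(\<Sum>k\<in>I. card (?B k)) < (\<Sum>k\<in>I. card (A k))"
      proof (rule sum_strict_mono_ex1[OF assms(1)])
        show "\<forall>k\<in>I. card (?B k) \<le> card (A k)"
          using fin by (auto intro: card_mono)
        show "\<exists>k\<in>I. card (?B k) < card (A k)"
          using i card_Diff1_less[OF fin[OF i] z] by (intro bexI[of _ i]) simp_all
      qed
      moreover have "finite (?B k)" if "k \<in> I" for k
        using fin that by auto
      ultimately have "\<exists>f. inj_on f I \<and> (\<forall>k\<in>I. f k \<in> ?B k)"
        by (rule less.hyps) (auto intro!: ok simp del: fun_upd_apply)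
      then obtain f where "inj_on f I" "\<forall>k\<in>I. f k \<in> ?B k"
        by blast
      moreover have "?B k \<subseteq> A k" for k by auto
      ultimately show ?thesis by blast
    qed
    \<comment> \<open>A family violating Hall's condition after the deletion of \<open>z\<close>
      must contain \<open>i\<close>. Here \<open>J\<close> is that family without \<open>i\<close>,
      which turns the strict violation into \<open>\<le> card J\<close>.\<close>
    have tight: "\<exists>J. J \<subseteq> I - {i} \<and> card (\<Union>(A ` J) \<union> (A i - {z})) \<le> card J"
      if z: "z \<in> A i" and contra: "\<not> ?thesis" for z
    proof -
      obtain J where J: "J \<subseteq> I" and viol: "\<not> card J \<le> card (\<Union>((A(i := A i - {z})) ` J))"
        using step[OF z] contra by blast
      have "i \<in> J"
      proof (rule ccontr)
        assume "i \<notin> J"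
        then have "(A(i := A i - {z})) ` J = A ` J" by auto
        with viol hall[OF J] show False by metis
      qed
      have union: "\<Union>((A(i := A i - {z})) ` J) = \<Union>(A ` (J - {i})) \<union> (A i - {z})"
        using \<open>i \<in> J\<close> by auto
      have "finite J"
        using J assms(1) finite_subset by blast
      then have "card (\<Union>(A ` (J - {i})) \<union> (A i - {z})) \<le> card (J - {i})"
        using viol \<open>i \<in> J\<close> unfolding union by simp
      with J show ?thesis by blast
    qed
    show ?thesis
    proof (rule ccontr)
      assume contra: "\<not> ?thesis"
      obtain J where J: "J \<subseteq> I - {i}" "card (\<Union>(A ` J) \<union> (A i - {x})) \<le> card J"
        using tight[OF xy(1) contra] by blast
      obtain K where K: "K \<subseteq> I - {i}" "card (\<Union>(A ` K) \<union> (A i - {y})) \<le> card K"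
        using tight[OF xy(2) contra] by blast
      \<comment> \<open>Since \<open>x \<noteq> y\<close>, the union of \<open>?P\<close> and
        \<open>?Q\<close> recovers all of \<open>A i\<close>. Hall's condition for
        \<open>insert i (J \<union> K)\<close> and for \<open>J \<inter> K\<close> then gives |J| +
        |K| + 1 \<le> |P| + |Q|, one more than tightness allows.\<close>
      let ?P = "\<Union>(A ` J) \<union> (A i - {x})" and ?Q = "\<Union>(A ` K) \<union> (A i - {y})"
      have finJK: "finite J" "finite K"
        using J(1) K(1) assms(1) by (meson finite_Diff finite_subset)+
      have finPQ: "finite ?P" "finite ?Q"
        using finJK J(1) K(1) fin i by auto
      have "insert i (J \<union> K) \<subseteq> I" "J \<inter> K \<subseteq> I"
        using i J(1) K(1) by auto
      then have *: "card (insert i (J \<union> K)) \<le> card (\<Union>(A ` insert i (J \<union> K)))"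
        "card (J \<inter> K) \<le> card (\<Union>(A ` (J \<inter> K)))"
        by (simp_all only: hall)
      have "\<Union>(A ` insert i (J \<union> K)) = ?P \<union> ?Q"
        using xy by auto
      then have "card (\<Union>(A ` insert i (J \<union> K))) = card (?P \<union> ?Q)"
        by (rule arg_cong)
      moreover have "card (\<Union>(A ` (J \<inter> K))) \<le> card (?P \<inter> ?Q)"
        using finPQ by (intro card_mono) auto
      moreover have "card (insert i (J \<union> K)) = Suc (card (J \<union> K))"
        using finJK J(1) K(1) by (intro card_insert_disjoint) auto
      ultimately have "Suc (card (J \<union> K) + card (J \<inter> K)) \<le> card (?P \<union> ?Q) + card (?P \<inter> ?Q)"
        using * by linarith
      also have "\<dots> = card ?P + card ?Q"
        using finPQ card_Un_Int by metis
      also have "\<dots> \<le> card J + card K"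
        using J(2) K(2) by linarith
      also have "\<dots> = card (J \<union> K) + card (J \<inter> K)"
        using finJK card_Un_Int by metis
      finally show False by simp
    qed
  qed
qed

section \<open>Finiteness and the extremal parameters of a graph\<close>

context
  fixes V :: "'a set" and E :: "'a set set"
  assumes graph: "fin_simple_graph V E"
begin

lemma finite_vertices: "finite V"
  using graph by (simp add: fin_simple_graph_def)

lemma edge_subset: "e \<in> E \<Longrightarrow> e \<subseteq> V"
  using graph by (auto simp: fin_simple_graph_def nsets_def)

lemma card_edge: "e \<in> E \<Longrightarrow> card e = 2"
  using graph by (auto simp: fin_simple_graph_def nsets_def)

lemma finite_edges: "finite E"
  using finite_vertices edge_subset by (meson PowI finite_Pow_iff finite_subset subsetI)

lemma edgeD:
  assumes "{v, w} \<in> E"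
  shows "v \<in> V" "w \<in> V" "v \<noteq> w"
  using edge_subset[OF assms] card_edge[OF assms] by auto

lemma finite_indep_cards: "finite {card S | S. S \<subseteq> V \<and> indep S E}"
  by (rule finite_subset[of _ "card ` Pow V"]) (auto simp: finite_vertices)

lemma card_le_indep_number:
  "S \<subseteq> V \<Longrightarrow> indep S E \<Longrightarrow> card S \<le> indep_number V E"
  unfolding indep_number_def by (rule Max_ge[OF finite_indep_cards]) auto

lemma finite_matching_cards: "finite {card M | M. matching E M}"
  by (rule finite_subset[of _ "card ` Pow E"]) (auto simp: finite_edges matching_def)

lemma card_le_matching_number: "matching E M \<Longrightarrow> card M \<le> matching_number E"
  unfolding matching_number_def by (rule Max_ge[OF finite_matching_cards]) auto

lemma maximum_matching_exists:
  obtains M where "matching E M" "card M = matching_number E"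
proof -
  have "matching E {}"
    by (simp add: matching_def)
  then have "matching_number E \<in> {card M | M. matching E M}"
    unfolding matching_number_def by (intro Max_in[OF finite_matching_cards]) auto
  with that show ?thesis by auto
qed

lemma finite_diff_sets: "finite {diff_set V E X | X. X \<subseteq> V}"
  by (rule finite_subset[of _ "diff_set V E ` Pow V"]) (auto simp: finite_vertices)

lemma diff_set_le_diff_graph: "X \<subseteq> V \<Longrightarrow> diff_set V E X \<le> diff_graph V E"
  unfolding diff_graph_def by (rule Max_ge[OF finite_diff_sets]) auto

lemma criticalI:
  assumes "X \<subseteq> V" and "\<And>Y. Y \<subseteq> V \<Longrightarrow> diff_set V E Y \<le> diff_set V E X"
  shows "critical V E X"
proof -
  have "diff_graph V E = diff_set V E X"
    unfolding diff_graph_def by (rule Max_eqI[OF finite_diff_sets]) (use assms in auto)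
  with assms(1) show ?thesis
    by (simp add: critical_def)
qed

section \<open>Unions and intersections of maximum independent sets\<close>

lemma nbhd_Union_max_indep_sets:
  assumes L: "\<Lambda> \<subseteq> max_indep_sets V E"
  shows "nbhd V E (\<Union>\<Lambda>) = V - \<Inter>\<Lambda>"
proof (intro equalityI subsetI)
  fix v assume "v \<in> nbhd V E (\<Union>\<Lambda>)"
  then obtain S x where "v \<in> V" "S \<in> \<Lambda>" "x \<in> S" "{x, v} \<in> E"
    by (auto simp: nbhd_def)
  moreover have "indep S E"
    using L \<open>S \<in> \<Lambda>\<close> by (auto simp: max_indep_sets_def)
  ultimately show "v \<in> V - \<Inter>\<Lambda>"
    using edgeD(3) unfolding indep_def by blast
next
  fix v assume "v \<in> V - \<Inter>\<Lambda>"
  then obtain S where v: "v \<in> V" and S: "S \<in> \<Lambda>" "v \<notin> S" by blast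
  then have S': "S \<subseteq> V" "indep S E" "card S = indep_number V E"
    using L by (auto simp: max_indep_sets_def)
  \<comment> \<open>Maximality of \<open>S\<close> is used here: \<open>insert v S\<close> is too
    large to be independent, and the offending edge must join \<open>v\<close> to
    \<open>S\<close>.\<close>
  have "card (insert v S) > indep_number V E"
    using S' S(2) finite_subset[OF S'(1) finite_vertices] by simp
  then have "\<not> indep (insert v S) E"
    using card_le_indep_number[of "insert v S"] v S'(1) by auto
  then obtain x where "x \<in> S" "{x, v} \<in> E"
    using S'(2) unfolding indep_def by (metis insert_commute insert_iff)
  then show "v \<in> nbhd V E (\<Union>\<Lambda>)"
    using v S(1) by (auto simp: nbhd_def)
qed

lemma diff_set_Union_max_indep_sets:
  assumes L: "\<Lambda> \<subseteq> max_indep_sets V E" and ne: "\<Lambda> \<noteq> {}"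
  shows "diff_set V E (\<Union>\<Lambda>) = int (card (\<Union>\<Lambda>)) + int (card (\<Inter>\<Lambda>)) - int (card V)"
proof -
  \<comment> \<open>Nonemptiness matters here, as \<open>\<Inter>{}\<close> is
    \<open>UNIV\<close>.\<close>
  have sub: "\<Inter>\<Lambda> \<subseteq> V"
    using L ne by (auto simp: max_indep_sets_def)
  then have "card (V - \<Inter>\<Lambda>) = card V - card (\<Inter>\<Lambda>)" "card (\<Inter>\<Lambda>) \<le> card V"
    using finite_vertices by (auto intro: card_Diff_subset finite_subset card_mono)
  then show ?thesis
    unfolding diff_set_def nbhd_Union_max_indep_sets[OF L] by simp
qed

section \<open>Matchings and counting bounds\<close>

text \<open>Turns a family of disjoint edges into an involution on the covered vertices, whose
  injectivity drives all later counts. It is an involution because the edges chosen at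
  \<open>v\<close> and at \<open>p v\<close> share \<open>p v\<close> and hence coincide.\<close>

lemma matching_partner:
  assumes "matching E M"
  obtains p where "\<And>v. v \<in> \<Union>M \<Longrightarrow> {v, p v} \<in> E"
    and "\<And>v. v \<in> \<Union>M \<Longrightarrow> p v \<in> \<Union>M"
    and "\<And>v. v \<in> \<Union>M \<Longrightarrow> p (p v) = v"
proof -
  have M: "M \<subseteq> E" "disjoint M"
    using assms by (auto simp: matching_def)
  have "\<exists>w. {v, w} \<in> M" if v: "v \<in> \<Union>M" for v
  proof -
    from v obtain e where e: "e \<in> M" "v \<in> e" by blast
    then have "card e = 2"
      using M(1) card_edge by blast
    then obtain a b where "e = {a, b}"
      by (auto simp: card_2_iff)
    with e show ?thesis
      by (metis insert_commute insertE singletonD)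
  qed
  then obtain p where p: "\<And>v. v \<in> \<Union>M \<Longrightarrow> {v, p v} \<in> M"
    by metis
  have p': "p v \<in> \<Union>M" if "v \<in> \<Union>M" for v
    using p[OF that] by blast
  have "p (p v) = v" if v: "v \<in> \<Union>M" for v
  proof -
    have "{p v, p (p v)} \<inter> {v, p v} \<noteq> {}"
      by blast
    then have "{p v, p (p v)} = {v, p v}"
      using p[OF v] p[OF p'[OF v]] M(2) unfolding disjoint_def by metis
    moreover have "p v \<noteq> v"
      using edgeD(3)[of v "p v"] p[OF v] M(1) by auto
    ultimately show ?thesis
      by (auto simp: doubleton_eq_iff)
  qed
  with that p p' M(1) show ?thesis by blast
qed

lemma Union_matching_subset: "matching E M \<Longrightarrow> \<Union>M \<subseteq> V"
  using edge_subset by (auto simp: matching_def)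

lemma card_Union_matching:
  assumes "matching E M"
  shows "card (\<Union>M) = 2 * card M"
proof -
  have M: "M \<subseteq> E" "disjoint M"
    using assms by (auto simp: matching_def)
  have "card (\<Union>M) = sum card M"
  proof (rule card_Union_disjoint)
    show "pairwise disjnt M"
      using M(2) by (auto simp: disjoint_def pairwise_def disjnt_def)
    show "finite e" if "e \<in> M" for e
      using that M(1) edge_subset finite_vertices finite_subset by blast
  qed
  also have "\<dots> = (\<Sum>e\<in>M. 2)"
    using M(1) card_edge by (intro sum.cong) auto
  finally show ?thesis by simp
qed

text \<open>The partner map sends the matched part of \<open>X\<close> injectively into N(X), so
  d(X) is at most the number of vertices missed by \<open>M\<close>.\<close>

lemma diff_set_le_unmatched:
  assumes M: "matching E M" and X: "X \<subseteq> V"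
  shows "diff_set V E X \<le> int (card V) - 2 * int (card M)"
proof -
  obtain p where p: "\<And>v. v \<in> \<Union>M \<Longrightarrow> {v, p v} \<in> E"
    and "\<And>v. v \<in> \<Union>M \<Longrightarrow> p v \<in> \<Union>M" and inv: "\<And>v. v \<in> \<Union>M \<Longrightarrow> p (p v) = v"
    using matching_partner[OF M] by metis
  have fin: "finite X" "finite (\<Union>M)"
    using X Union_matching_subset[OF M] finite_vertices finite_subset by blast+
  have "card (X \<inter> \<Union>M) \<le> card (nbhd V E X)"
  proof (rule card_inj_on_le[of p])
    show "inj_on p (X \<inter> \<Union>M)"
      using inv by (intro inj_on_inverseI[of _ p]) auto
    show "p ` (X \<inter> \<Union>M) \<subseteq> nbhd V E X"
      using p edgeD(2) by (fastforce simp: nbhd_def)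
    show "finite (nbhd V E X)"
      using finite_vertices by (simp add: nbhd_def)
  qed
  moreover have "card (X - \<Union>M) \<le> card (V - \<Union>M)"
    using X finite_vertices by (intro card_mono) auto
  moreover have "card X = card (X \<inter> \<Union>M) + card (X - \<Union>M)"
    using fin(1) by (metis card_Int_Diff)
  moreover have "card V = card (\<Union>M) + card (V - \<Union>M)"
    using card_Int_Diff[OF finite_vertices, of "\<Union>M"] Union_matching_subset[OF M]
    by (simp add: Int_absorb1)
  ultimately show ?thesis
    unfolding diff_set_def card_Union_matching[OF M, symmetric]
    using card_Union_matching[OF M] by linarith
qed

text \<open>\<open>S\<close> contains at most one end of each edge of \<open>M\<close> and at most
  all of the |V| - 2|M| unmatched vertices. Equality in the sum forces equality in both estimates,
  which fixes the shape of maximum independent sets in a Koenig-Egervary graph.\<close>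

lemma card_indep_matching_le:
  assumes M: "matching E M" and S: "S \<subseteq> V" "indep S E"
  shows "card S + card M \<le> card V"
    and "card S + card M = card V \<Longrightarrow> V - \<Union>M \<subseteq> S \<and> card (S \<inter> \<Union>M) = card M"
proof -
  obtain p where p: "\<And>v. v \<in> \<Union>M \<Longrightarrow> {v, p v} \<in> E"
    and p': "\<And>v. v \<in> \<Union>M \<Longrightarrow> p v \<in> \<Union>M" and inv: "\<And>v. v \<in> \<Union>M \<Longrightarrow> p (p v) = v"
    using matching_partner[OF M] by metis
  have fin: "finite S" "finite (\<Union>M)"
    using S Union_matching_subset[OF M] finite_vertices finite_subset by blast+
  have "card (\<Union>M \<inter> S) \<le> card (\<Union>M - S)"
  proof (rule card_inj_on_le[of p])
    show "inj_on p (\<Union>M \<inter> S)"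
      using inv by (intro inj_on_inverseI[of _ p]) auto
    show "p ` (\<Union>M \<inter> S) \<subseteq> \<Union>M - S"
    proof (rule image_subsetI)
      fix v assume v: "v \<in> \<Union>M \<inter> S"
      then have "{v, p v} \<in> E" "v \<noteq> p v" "p v \<in> \<Union>M"
        using p p' edgeD(3) by blast+
      with v S(2) show "p v \<in> \<Union>M - S"
        unfolding indep_def by blast
    qed
    show "finite (\<Union>M - S)"
      using fin by simp
  qed
  moreover have "card (\<Union>M) = card (\<Union>M \<inter> S) + card (\<Union>M - S)"
    using fin(2) by (metis card_Int_Diff)
  ultimately have 1: "card (S \<inter> \<Union>M) \<le> card M"
    using card_Union_matching[OF M] by (simp add: Int_commute)
  have 2: "card (S - \<Union>M) \<le> card (V - \<Union>M)"
    using S finite_vertices by (intro card_mono) auto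
  have 3: "card S = card (S \<inter> \<Union>M) + card (S - \<Union>M)"
    using fin(1) by (metis card_Int_Diff)
  have 4: "card V = 2 * card M + card (V - \<Union>M)"
    using card_Int_Diff[OF finite_vertices, of "\<Union>M"] Union_matching_subset[OF M]
      card_Union_matching[OF M] by (simp add: Int_absorb1)
  show "card S + card M \<le> card V"
    using 1 2 3 4 by linarith
  assume eq: "card S + card M = card V"
  then have "card (S - \<Union>M) = card (V - \<Union>M)" "card (S \<inter> \<Union>M) = card M"
    using 1 2 3 4 by linarith+
  moreover from this have "S - \<Union>M = V - \<Union>M"
    using S finite_vertices by (intro card_subset_eq) auto
  ultimately show "V - \<Union>M \<subseteq> S \<and> card (S \<inter> \<Union>M) = card M"
    by blast
qed

section \<open>The two implications\<close>

lemma konig_egervary_imp_critical: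
  assumes KE: "konig_egervary V E"
    and L: "\<Lambda> \<subseteq> max_indep_sets V E" and ne: "\<Lambda> \<noteq> {}"
  shows "critical V E (\<Union>\<Lambda>)" and "card (\<Inter>\<Lambda>) + card (\<Union>\<Lambda>) = 2 * indep_number V E"
proof -
  obtain M where M: "matching E M" and cM: "card M = matching_number E"
    by (rule maximum_matching_exists)
  let ?R = "\<Union>M"
  obtain p where p: "\<And>v. v \<in> ?R \<Longrightarrow> {v, p v} \<in> E"
    and p': "\<And>v. v \<in> ?R \<Longrightarrow> p v \<in> ?R" and inv: "\<And>v. v \<in> ?R \<Longrightarrow> p (p v) = v"
    using matching_partner[OF M] by metis
  have V: "card V = indep_number V E + card M"
    using KE cM by (simp add: konig_egervary_def)
  have finR: "finite ?R"
    using Union_matching_subset[OF M] finite_vertices finite_subset by blast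
  have inj: "inj_on p ?R"
    using inv by (intro inj_on_inverseI[of _ p]) auto
  have S: "S \<subseteq> V" "indep S E" "card S + card M = card V" if "S \<in> \<Lambda>" for S
    using that L V by (auto simp: max_indep_sets_def)
  have unmatched: "V - ?R \<subseteq> S" if "S \<in> \<Lambda>" for S
    using card_indep_matching_le(2)[OF M S[OF that]] by blast
  have swap: "p v \<in> S \<longleftrightarrow> v \<notin> S" if "S \<in> \<Lambda>" and v: "v \<in> ?R" for S v
  proof -
    have sub: "p ` (S \<inter> ?R) \<subseteq> ?R - S"
    proof (rule image_subsetI)
      fix v assume v: "v \<in> S \<inter> ?R"
      then have "{v, p v} \<in> E" "v \<noteq> p v" "p v \<in> ?R"
        using p p' edgeD(3) by blast+
      with v S(2)[OF \<open>S \<in> \<Lambda>\<close>] show "p v \<in> ?R - S"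
        unfolding indep_def by blast
    qed
    have "card (S \<inter> ?R) = card M"
      using card_indep_matching_le(2)[OF M S[OF \<open>S \<in> \<Lambda>\<close>]] by blast
    moreover have "card (p ` (S \<inter> ?R)) = card (S \<inter> ?R)"
      by (rule card_image) (use inj inj_on_subset in blast)
    moreover have "card (?R - S) = 2 * card M - card (S \<inter> ?R)"
      using card_Union_matching[OF M] card_Diff_subset_Int[of ?R S] finR by (simp add: Int_commute)
    \<comment> \<open>Both sides have |M| elements, because \<open>?R\<close> has 2|M| and
      \<open>S\<close> takes half of them.\<close>
    ultimately have img: "p ` (S \<inter> ?R) = ?R - S"
      using sub finR by (intro card_subset_eq) auto
    show ?thesis
    proof (cases "v \<in> S")
      case True
      with v sub show ?thesis by blast
    next
      case False
      with v img obtain u where "u \<in> S \<inter> ?R" "v = p u" by blast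
      with inv False show ?thesis by auto
    qed
  qed
  \<comment> \<open>By \<open>swap\<close>, \<open>p w\<close> lies in a given member of \<Lambda>
    iff \<open>w\<close> does not; so \<open>p w\<close> lies in some member iff \<open>w\<close> is
    missing from some member.\<close>
  have "p ` (\<Union>\<Lambda> \<inter> ?R) = ?R - \<Inter>\<Lambda>"
  proof (intro equalityI subsetI)
    fix w assume "w \<in> p ` (\<Union>\<Lambda> \<inter> ?R)"
    then show "w \<in> ?R - \<Inter>\<Lambda>"
      using swap p' by blast
  next
    fix w assume w: "w \<in> ?R - \<Inter>\<Lambda>"
    then have "p w \<in> \<Union>\<Lambda> \<inter> ?R"
      using swap p' by blast
    with w inv show "w \<in> p ` (\<Union>\<Lambda> \<inter> ?R)"
      by (metis DiffD1 image_eqI)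
  qed
  moreover have "card (p ` (\<Union>\<Lambda> \<inter> ?R)) = card (\<Union>\<Lambda> \<inter> ?R)"
    by (rule card_image) (use inj inj_on_subset in blast)
  ultimately have "card (\<Union>\<Lambda> \<inter> ?R) = card (?R - \<Inter>\<Lambda>)"
    by simp
  moreover have "card ?R = card (\<Inter>\<Lambda> \<inter> ?R) + card (?R - \<Inter>\<Lambda>)"
    using card_Int_Diff[OF finR, of "\<Inter>\<Lambda>"] by (simp add: Int_commute)
  moreover have subV: "\<Union>\<Lambda> \<subseteq> V" "\<Inter>\<Lambda> \<subseteq> V"
    using S(1) ne by auto
  \<comment> \<open>Outside \<open>?R\<close> all members of \<Lambda> agree, so |U| + |I| = |R| +
    2|V - R| = 2|V| - 2|M| = 2\<alpha>.\<close>
  moreover have "\<Union>\<Lambda> - ?R = V - ?R" "\<Inter>\<Lambda> - ?R = V - ?R"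
    using subV unmatched ne by blast+
  then have "card (\<Union>\<Lambda>) = card (\<Union>\<Lambda> \<inter> ?R) + card (V - ?R)"
    "card (\<Inter>\<Lambda>) = card (\<Inter>\<Lambda> \<inter> ?R) + card (V - ?R)"
    using subV finite_vertices by (metis card_Int_Diff finite_subset)+
  moreover have "card V = 2 * card M + card (V - ?R)"
    using card_Int_Diff[OF finite_vertices, of ?R] Union_matching_subset[OF M]
      card_Union_matching[OF M] by (simp add: Int_absorb1)
  ultimately show sum: "card (\<Inter>\<Lambda>) + card (\<Union>\<Lambda>) = 2 * indep_number V E"
    using V card_Union_matching[OF M] by linarith
  show "critical V E (\<Union>\<Lambda>)"
  proof (rule criticalI[OF subV(1)])
    fix Y assume "Y \<subseteq> V"
    from diff_set_le_unmatched[OF M this]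
    show "diff_set V E Y \<le> diff_set V E (\<Union>\<Lambda>)"
      using diff_set_Union_max_indep_sets[OF L ne] sum V by linarith
  qed
qed

lemma critical_imp_konig_egervary:
  assumes L: "\<Lambda> \<subseteq> max_indep_sets V E" and ne: "\<Lambda> \<noteq> {}"
    and crit: "critical V E (\<Union>\<Lambda>)"
    and sum: "card (\<Inter>\<Lambda>) + card (\<Union>\<Lambda>) = 2 * indep_number V E"
  shows "konig_egervary V E"
proof -
  from ne L obtain S where S: "S \<subseteq> V" "indep S E" "card S = indep_number V E"
    by (auto simp: max_indep_sets_def)
  have finS: "finite S"
    using S(1) finite_vertices finite_subset by blast
  have dG: "diff_graph V E = 2 * int (card S) - int (card V)"
    using crit diff_set_Union_max_indep_sets[OF L ne] sum S(3) by (simp add: critical_def)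
  have cVS: "card V = card S + card (V - S)"
    using card_Int_Diff[OF finite_vertices, of S] S(1) by (simp add: Int_absorb1)
  let ?N = "\<lambda>v. {s \<in> S. {v, s} \<in> E}"
  have "\<exists>f. inj_on f (V - S) \<and> (\<forall>v\<in>V - S. f v \<in> ?N v)"
  proof (rule hall_marriage)
    show "finite (V - S)"
      using finite_vertices by simp
    show "finite (?N v)" for v
      using finS by simp
    fix A assume A: "A \<subseteq> V - S"
    \<comment> \<open>Deleting the neighbours of \<open>A\<close> from \<open>S\<close> leaves a set
      whose neighbourhood misses both \<open>S\<close> and \<open>A\<close>. Hence |X| - (|V - S| -
      |A|) \<le> d(X) \<le> d(G) = |S| - |V - S|, that is, |A| \<le> |S| - |X|.\<close>
    let ?X = "S - \<Union>(?N ` A)"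
    have "nbhd V E ?X \<subseteq> (V - S) - A"
    proof
      fix v assume "v \<in> nbhd V E ?X"
      then obtain x where v: "v \<in> V" and x: "x \<in> S" "x \<notin> \<Union>(?N ` A)" "{x, v} \<in> E"
        by (auto simp: nbhd_def)
      then have "{v, x} \<in> E" by (simp add: insert_commute)
      with x have "v \<notin> A" by blast
      moreover have "v \<notin> S"
        using S(2) x edgeD(3) unfolding indep_def by blast
      ultimately show "v \<in> (V - S) - A"
        using v by blast
    qed
    then have "card (nbhd V E ?X) \<le> card ((V - S) - A)"
      using finite_vertices by (intro card_mono) auto
    also have "\<dots> = card (V - S) - card A"
      using A finite_vertices by (meson card_Diff_subset finite_Diff finite_subset)
    finally have "card (nbhd V E ?X) \<le> card (V - S) - card A" .
    \<comment> \<open>Ensures that the natural-number subtraction above does not truncate.\<close>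
    moreover have "card A \<le> card (V - S)"
      using A finite_vertices by (intro card_mono) auto
    moreover have "card S = card ?X + card (\<Union>(?N ` A))"
    proof -
      have "S \<inter> \<Union>(?N ` A) = \<Union>(?N ` A)" by blast
      then show ?thesis
        using card_Int_Diff[OF finS, of "\<Union>(?N ` A)"] by simp
    qed
    moreover have "diff_set V E ?X \<le> diff_graph V E"
      using S(1) by (intro diff_set_le_diff_graph) blast
    ultimately show "card A \<le> card (\<Union>(?N ` A))"
      unfolding diff_set_def dG using cVS by linarith
  qed
  then obtain f where inj: "inj_on f (V - S)" and f: "\<And>v. v \<in> V - S \<Longrightarrow> f v \<in> S \<and> {v, f v} \<in> E"
    by blast
  let ?M = "(\<lambda>v. {v, f v}) ` (V - S)"
  \<comment> \<open>As \<open>f\<close> maps into \<open>S\<close>, two such edges can meet only in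
    \<open>v = w\<close> or \<open>f v = f w\<close>. This gives both the disjointness of the edges
    and the injectivity needed to count them.\<close>
  have edges_eq: "v = w" if "v \<in> V - S" "w \<in> V - S" "{v, f v} \<inter> {w, f w} \<noteq> {}" for v w
  proof -
    have "v \<noteq> f w" "w \<noteq> f v"
      using that(1,2) f[of v] f[of w] by blast+
    then have "v = w \<or> f v = f w"
      using that(3) by blast
    then show ?thesis
      using inj_onD[OF inj _ that(1,2)] by blast
  qed
  have "matching E ?M"
    unfolding matching_def disjoint_def using f edges_eq by blast
  moreover have "card ?M = card (V - S)"
    using edges_eq by (intro card_image inj_onI) blast
  ultimately have "card (V - S) \<le> matching_number E"
    using card_le_matching_number by metis
  \<comment> \<open>This inequality holds in every graph; the matching just built supplies the
    reverse one.\<close>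
  moreover have "indep_number V E + matching_number E \<le> card V"
    using maximum_matching_exists card_indep_matching_le(1)[OF _ S(1,2)] S(3) by metis
  ultimately show ?thesis
    unfolding konig_egervary_def using cVS S(3) by linarith
qed

end

theorem theorem3p6:
  fixes V :: "'a set" and E :: "'a set set" and \<Lambda> :: "'a set set"
  assumes "fin_simple_graph V E"
    and "\<Lambda> \<subseteq> max_indep_sets V E"
    and "card \<Lambda> \<ge> 1"
  shows "konig_egervary V E \<longleftrightarrow>
    critical V E (\<Union>\<Lambda>) \<and> card (\<Inter>\<Lambda>) + card (\<Union>\<Lambda>) = 2 * indep_number V E"
proof -
  have "\<Lambda> \<noteq> {}"
    using assms(3) by auto
  then show ?thesis
    using konig_egervary_imp_critical[OF assms(1) _ assms(2)]
      critical_imp_konig_egervary[OF assms(1,2)] by blast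
qed

end
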